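(* Let $\tau$ be the standard Euclidean topology on $\mathbb{R}$. Then there exists a rough family $\mathscr{F}=\{F_\eta:\eta\in\mathbb{R}\}$ of subsets of $\mathbb{R}$ such that, for each ideal $\mathcal{I}$ on $\omega$, there is no ideal $\mathcal{J}$ on $\omega$ and no topology $\nu$ on $\mathbb{R}$ for which the equivalence $$(\mathcal{I},\mathscr{F},\tau)\text{-}\lim_n x_n=\eta \quad\text{ if and only if }\quad (\mathcal{J},\nu)\text{-}\lim_n x_n=\eta$$ holds for all real sequences $(x_n)_{n\in\omega}$ and all $\eta\in\mathbb{R}$.
   Context: $\omega$ denotes the set of nonnegative integers. An ideal on $\omega$ is a family $\mathcal{I}\subseteq\mathcal{P}(\omega)$ closed under subsets and finite unions, containing all finite subsets of $\omega$, and with $\omega\notin\mathcal{I}$. A rough family on a topological space $(X,\tau)$ is a collection $\mathscr{F}=\{F_\eta:\eta\in X\}$ of subsets of $X$ such that $\eta\in F_\eta$ for all $\eta\in X$. A sequence $(x_n)_{n\in\omega}$ in $X$ is $\mathcal{I}$-convergent to $\eta\in X$ with roughness $\mathscr{F}$, written $(\mathcal{I},\mathscr{F},\tau)\text{-}\lim_n x_n=\eta$, if $\{n\in\omega: x_n\notin U\}\in\mathcal{I}$ for all $\tau$-open sets $U\subseteq X$ with $F_\eta\subseteq U$. For an ideal $\mathcal{J}$ on $\omega$ and a topology $\nu$ on $X$ (not assumed Hausdorff), $(\mathcal{J},\nu)\text{-}\lim_n x_n=\eta$ means that $\{n\in\omega: x_n\notin U\}\in\mathcal{J}$ for all $\nu$-open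 sets $U$ containing $\eta$. *)

theory Defs
  imports "HOL-Analysis.Analysis"
begin

definition omega_ideal :: "nat set set \<Rightarrow> bool" where
  "omega_ideal \<I> \<longleftrightarrow>
     (\<forall>A B. A \<in> \<I> \<longrightarrow> B \<subseteq> A \<longrightarrow> B \<in> \<I>) \<and>
     (\<forall>A B. A \<in> \<I> \<longrightarrow> B \<in> \<I> \<longrightarrow> A \<union> B \<in> \<I>) \<and>
     (\<forall>A. finite A \<longrightarrow> A \<in> \<I>) \<and>
     UNIV \<notin> \<I>"

definition rough_family :: "'a topology \<Rightarrow> ('a \<Rightarrow> 'a set) \<Rightarrow> bool" where
  "rough_family \<tau> F \<longleftrightarrow> (\<forall>\<eta> \<in> topspace \<tau>. F \<eta> \<subseteq> topspace \<tau> \<and> \<eta> \<in> F \<eta>)"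

text \<open>The underlying set of a space is its \<open>topspace\<close>; as with \<open>limitin\<close>, the limit
  point is required to belong to it, and here so are the terms of the sequence.\<close>

definition rough_ideal_lim ::
  "nat set set \<Rightarrow> ('a \<Rightarrow> 'a set) \<Rightarrow> 'a topology \<Rightarrow> (nat \<Rightarrow> 'a) \<Rightarrow> 'a \<Rightarrow> bool" where
  "rough_ideal_lim \<I> F \<tau> x \<eta> \<longleftrightarrow>
     range x \<subseteq> topspace \<tau> \<and> \<eta> \<in> topspace \<tau> \<and>
     (\<forall>U. openin \<tau> U \<and> F \<eta> \<subseteq> U \<longrightarrow> {n. x n \<notin> U} \<in> \<I>)"

definition ideal_lim ::
  "nat set set \<Rightarrow> 'a topology \<Rightarrow> (nat \<Rightarrow> 'a) \<Rightarrow> 'a \<Rightarrow> bool" where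
  "ideal_lim \<J> \<nu> x \<eta> \<longleftrightarrow>
     range x \<subseteq> topspace \<nu> \<and> \<eta> \<in> topspace \<nu> \<and>
     (\<forall>U. openin \<nu> U \<and> \<eta> \<in> U \<longrightarrow> {n. x n \<notin> U} \<in> \<J>)"

end

theory Submission
  imports Defs
begin

text \<open>A constant sequence \<open>a\<close> converges to \<open>\<eta>\<close> in a topology iff \<open>a\<close> lies in every
  neighbourhood of \<open>\<eta>\<close>, and this relation is transitive. With roughness \<open>F\<close> over a \<open>T\<^sub>1\<close>
  topology it means \<open>a \<in> F \<eta>\<close>, which fails to be transitive for \<open>F \<eta> = {\<eta>, \<eta> + 1}\<close>.\<close>

text \<open>The set is empty or all of \<omega>; an ideal contains the former and omits the
  latter.\<close>

lemma omega_ideal_const_iff: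
  assumes "omega_ideal \<I>"
  shows "{n :: nat. P} \<in> \<I> \<longleftrightarrow> \<not> P"
  using assms unfolding omega_ideal_def by (cases P) simp_all

lemma ideal_lim_const_iff:
  assumes "omega_ideal \<J>"
  shows "ideal_lim \<J> \<nu> (\<lambda>n. a) \<eta> \<longleftrightarrow>
    a \<in> topspace \<nu> \<and> \<eta> \<in> topspace \<nu> \<and> (\<forall>U. openin \<nu> U \<and> \<eta> \<in> U \<longrightarrow> a \<in> U)"
  unfolding ideal_lim_def omega_ideal_const_iff[OF assms] by simp

text \<open>An open set around \<open>c\<close> must contain \<open>b\<close>, so it is also an open
  set around \<open>b\<close> and must contain \<open>a\<close>.\<close>

lemma ideal_lim_const_trans:
  assumes "omega_ideal \<J>" "ideal_lim \<J> \<nu> (\<lambda>n. a) b" "ideal_lim \<J> \<nu> (\<lambda>n. b) c"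
  shows "ideal_lim \<J> \<nu> (\<lambda>n. a) c"
  using assms(2,3) unfolding ideal_lim_const_iff[OF assms(1)] by blast

lemma rough_ideal_lim_const_iff:
  fixes a \<eta> :: "'a::t1_space"
  assumes "omega_ideal \<I>"
  shows "rough_ideal_lim \<I> F euclidean (\<lambda>n. a) \<eta> \<longleftrightarrow> a \<in> F \<eta>"
proof
  assume lim: "rough_ideal_lim \<I> F euclidean (\<lambda>n. a) \<eta>"
  show "a \<in> F \<eta>"
  proof (rule ccontr)
    assume "a \<notin> F \<eta>"
    \<comment> \<open>Points are closed in a T1 space, so the complement of \<open>a\<close> is an
      admissible test set; the constant sequence misses it at every index.\<close>
    then have "open (- {a})" "F \<eta> \<subseteq> - {a}" by auto
    with lim have "{n :: nat. a \<notin> - {a}} \<in> \<I>"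
      unfolding rough_ideal_lim_def by (metis open_openin)
    then show False unfolding omega_ideal_const_iff[OF assms] by simp
  qed
next
  assume "a \<in> F \<eta>"
  then show "rough_ideal_lim \<I> F euclidean (\<lambda>n. a) \<eta>"
    unfolding rough_ideal_lim_def omega_ideal_const_iff[OF assms] by auto
qed

theorem proposition1p2:
  shows "\<exists>F :: real \<Rightarrow> real set. rough_family euclideanreal F \<and>
    (\<forall>\<I>. omega_ideal \<I> \<longrightarrow>
      \<not> (\<exists>\<J> (\<nu> :: real topology). omega_ideal \<J> \<and> topspace \<nu> = UNIV \<and>
          (\<forall>(x :: nat \<Rightarrow> real) (\<eta> :: real).
             rough_ideal_lim \<I> F euclideanreal x \<eta> \<longleftrightarrow> ideal_lim \<J> \<nu> x \<eta>)))"
proof (rule exI[of _ "\<lambda>\<eta>. {\<eta>, \<eta> + 1}"], intro conjI allI impI notI)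
  let ?F = "\<lambda>\<eta> :: real. {\<eta>, \<eta> + 1}"
  show "rough_family euclideanreal ?F"
    by (simp add: rough_family_def)
  fix \<I>
  assume \<I>: "omega_ideal \<I>"
  assume "\<exists>\<J> (\<nu> :: real topology). omega_ideal \<J> \<and> topspace \<nu> = UNIV \<and>
    (\<forall>x \<eta>. rough_ideal_lim \<I> ?F euclideanreal x \<eta> \<longleftrightarrow> ideal_lim \<J> \<nu> x \<eta>)"
  then obtain \<J> and \<nu> :: "real topology" where \<J>: "omega_ideal \<J>"
    and eq: "\<And>x \<eta>. rough_ideal_lim \<I> ?F euclideanreal x \<eta> \<longleftrightarrow> ideal_lim \<J> \<nu> x \<eta>"
    by blast
  have const: "ideal_lim \<J> \<nu> (\<lambda>n. a) \<eta> \<longleftrightarrow> a \<in> ?F \<eta>" for a \<eta>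
    unfolding eq[symmetric] by (rule rough_ideal_lim_const_iff[OF \<I>])
  \<comment> \<open>Transitivity breaks along 2, 1, 0: \<open>2 \<in> ?F 1\<close> and
    \<open>1 \<in> ?F 0\<close>, but 2 is not in \<open>?F 0 = {0, 1}\<close>.\<close>
  show False
    using ideal_lim_const_trans[OF \<J>, of \<nu> 2 1 0] by (simp add: const)
qed

end
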